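(* Any (randomized) algorithm that reports majority exactly, that is, solves the majority problem on $n$ balls and is always correct irrespective of its random choices, requires in expectation at least $1.019n$ comparisons.
   Context: Majority problem: there are $n$ balls, identified with $1,2,\ldots,n$, each having a color (the number of possible colors is unbounded). The coloring is fixed in advance and unknown to the algorithm. The only access to the colors is through comparisons: the algorithm chooses (adaptively) two balls $i,j$ and learns whether they have the same color. A majority color is a color shared by more than $\lfloor n/2\rfloor$ balls. The algorithm must either output a ball of the majority color or report that there is no majority color. The cost is the number of comparisons made; for a randomized algorithm on a fixed coloring it is a random variable depending only on the algorithm's random choices. "Requires in expectation at least $1.019n$ comparisons" refers to the worst-case coloring: there is a coloring of the $n$ balls on which the expected number of comparisons is at least $1.019n$.
   Formalization: The bound of 1.019n expected comparisons is stated for all sufficiently large n (one threshold for all algorithms), since it fails for small n: one ball needs 0 comparisons, two balls need 1, and three balls need at most 3. *)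

theory Defs
  imports "HOL-Probability.Probability"
begin

text \<open>
  A deterministic comparison algorithm is a binary decision tree. \<open>Report (Some b)\<close> claims
  that \<open>b\<close> has the majority color, \<open>Report None\<close> claims that there is no majority color;
  \<open>Compare i j s d\<close> compares \<open>i\<close> and \<open>j\<close>, continuing with \<open>s\<close> if the colors agree and
  with \<open>d\<close> otherwise. A codatatype is used so that nonterminating runs, which a randomized
  algorithm may have with probability zero, are covered. The generated function \<open>set_algo\<close>
  collects all balls that are compared or reported anywhere in the tree.
\<close>

codatatype (set_algo: 'b) algo =
    Report "'b option"
  | Compare 'b 'b "'b algo" "'b algo"

definition step :: "('b \<Rightarrow> 'c) \<Rightarrow> 'b algo \<Rightarrow> 'b algo" where
  "step c A = (case A of Report r \<Rightarrow> Report r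
                       | Compare i j s d \<Rightarrow> if c i = c j then s else d)"

definition reports_after :: "('b \<Rightarrow> 'c) \<Rightarrow> 'b algo \<Rightarrow> nat \<Rightarrow> 'b option \<Rightarrow> bool" where
  "reports_after c A k r \<longleftrightarrow> (step c ^^ k) A = Report r"

definition halts :: "('b \<Rightarrow> 'c) \<Rightarrow> 'b algo \<Rightarrow> bool" where
  "halts c A \<longleftrightarrow> (\<exists>k r. reports_after c A k r)"

text \<open>The infimum over the empty set is \<open>\<infinity>\<close>: nonterminating runs have infinite cost.\<close>

definition comparisons :: "('b \<Rightarrow> 'c) \<Rightarrow> 'b algo \<Rightarrow> ennreal" where
  "comparisons c A = (INF k \<in> {k. \<exists>r. reports_after c A k r}. of_nat k)"

definition majority_color :: "nat \<Rightarrow> (nat \<Rightarrow> 'c) \<Rightarrow> 'c \<Rightarrow> bool" where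
  "majority_color n c x \<longleftrightarrow> card {b \<in> {1..n}. c b = x} > n div 2"

definition correct_report :: "nat \<Rightarrow> (nat \<Rightarrow> 'c) \<Rightarrow> nat option \<Rightarrow> bool" where
  "correct_report n c r \<longleftrightarrow>
     (case r of None \<Rightarrow> \<not> (\<exists>x. majority_color n c x)
              | Some b \<Rightarrow> b \<in> {1..n} \<and> majority_color n c (c b))"

text \<open>
  A randomized algorithm on balls \<open>{1..n}\<close> is a probability distribution over deterministic
  ones: an algorithm drawing its random choices from an arbitrary probability space induces
  such a distribution as its image measure. The sigma-algebra is arbitrary, subject only to
  the cost on each coloring being a random variable. Colors are natural numbers, so their
  number is unbounded; the values of a coloring outside \<open>{1..n}\<close> are irrelevant.
\<close>

definition randomized_algo :: "nat \<Rightarrow> nat algo measure \<Rightarrow> bool" where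
  "randomized_algo n M \<longleftrightarrow>
     prob_space M \<and>
     (\<forall>A \<in> space M. set_algo A \<subseteq> {1..n}) \<and>
     (\<forall>c :: nat \<Rightarrow> nat. comparisons c \<in> borel_measurable M)"

text \<open>
  Correctness is required for every outcome of the random choices, not just almost surely;
  a run may fail to terminate, but only with probability zero.
\<close>

definition reports_majority_exactly :: "nat \<Rightarrow> nat algo measure \<Rightarrow> bool" where
  "reports_majority_exactly n M \<longleftrightarrow>
     (\<forall>c :: nat \<Rightarrow> nat.
        (\<forall>A \<in> space M. \<forall>k r. reports_after c A k r \<longrightarrow> correct_report n c r) \<and>
        (AE A in M. halts c A))"

definition expected_comparisons :: "nat algo measure \<Rightarrow> (nat \<Rightarrow> nat) \<Rightarrow> ennreal" where
  "expected_comparisons M c = (\<integral>\<^sup>+ A. comparisons c A \<partial>M)"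

end

theory Submission
  imports Defs "HOL-Real_Asymp.Real_Asymp"
begin

text \<open>
  Color a random set \<open>W\<close> of \<open>m = n div 2 + 1\<close> balls with one color and the rest with another. A query is
  a link if both answers are consistent with the two-colorings still possible; over all \<open>2 ^ n\<close>
  two-colorings each link is a fair coin flip, so an exponential supermartingale controls weighted
  counts of links with errors that survive conditioning on \<open>card W = m\<close>.

  Correctness on colorings with many colors forces the balls of \<open>W\<close> to be connected by positive
  answers, which costs \<open>m - 1\<close> queries. This also means that the run determines \<open>W\<close>, so that nearly
  all runs have nearly \<open>n\<close> links, about \<open>n / 2\<close> of them negative. The surplus over \<open>n\<close> comes from
  positive links inside the minority: recoloring a set \<open>V \<subseteq> W\<close> of \<open>2 * m - n\<close> balls exchanges the roles
  of majority and minority, yet goes unnoticed until a link touches \<open>V\<close>. Hence half of the positive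
  links made before that moment lie in the minority, on average over \<open>W\<close> and \<open>V\<close>. The \<open>t\<close>-th link
  precedes it with probability about \<open>(1 - 2 * t / m)\<^sup>2\<close> at least, and summing over \<open>t\<close> yields a surplus
  of \<open>n / 48 > 0.019 * n\<close>.
\<close>

subsection \<open>Transcripts\<close>

text \<open>The cutoff keeps the list finite even on a nonterminating run.\<close>

primrec transcript :: "('b \<Rightarrow> 'c) \<Rightarrow> 'b algo \<Rightarrow> nat \<Rightarrow> ('b \<times> 'b \<times> bool) list" where
  "transcript c A 0 = []"
| "transcript c A (Suc k) = (case A of Report r \<Rightarrow> []
     | Compare i j s d \<Rightarrow> (i, j, c i = c j) # transcript c (if c i = c j then s else d) k)"

abbreviation two_coloring :: "'b set \<Rightarrow> 'b \<Rightarrow> nat" where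
  "two_coloring S \<equiv> \<lambda>v. of_bool (v \<in> S)"

lemma step_Report [simp]: "step c (Report r) = Report r"
  by (simp add: step_def)

lemma step_Compare [simp]: "step c (Compare i j s d) = (if c i = c j then s else d)"
  by (simp add: step_def)

lemma funpow_step_Report [simp]: "(step c ^^ k) (Report r) = Report r"
  by (induction k) auto

lemma reports_after_mono:
  assumes "reports_after c A k r" "k \<le> k'"
  shows "reports_after c A k' r"
proof -
  obtain d where "k' = d + k" using assms(2) by (metis add.commute le_Suc_ex)
  then show ?thesis using assms(1) by (simp add: reports_after_def funpow_add)
qed

lemma length_transcript_le:
  "reports_after c A k' r \<Longrightarrow> length (transcript c A k) \<le> k'"
proof (induction k' arbitrary: A k)
  case 0
  then show ?case by (cases k) (auto simp: reports_after_def)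
next
  case (Suc k')
  show ?case
  proof (cases k)
    case (Suc l)
    show ?thesis
    proof (cases A)
      case (Compare i j s d)
      have "reports_after c (step c A) k' r"
        using Suc.prems by (simp add: reports_after_def funpow_Suc_right del: funpow.simps)
      from Suc.IH[OF this, of l] show ?thesis
        using Compare Suc by simp
    qed (use Suc in simp)
  qed simp
qed

lemma comparisons_ge_length_transcript:
  "of_nat (length (transcript c A k)) \<le> comparisons c A"
  unfolding comparisons_def
  by (rule INF_greatest) (auto intro: length_transcript_le)

lemma transcript_answers:
  "(i, j, e) \<in> set (transcript c A k) \<Longrightarrow> e \<longleftrightarrow> c i = c j"
  by (induction k arbitrary: A) (auto split: algo.splits)

lemma transcript_balls:
  "(i, j, e) \<in> set (transcript c A k) \<Longrightarrow> i \<in> set_algo A \<and> j \<in> set_algo A"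
  by (induction k arbitrary: A) (fastforce split: algo.splits if_splits)+

text \<open>Lets an adversary replace the coloring afterwards: the tree sees colors only through the
  recorded answers.\<close>

lemma funpow_step_cong:
  assumes "\<And>i j e. (i, j, e) \<in> set (transcript c A k) \<Longrightarrow> e \<longleftrightarrow> c' i = c' j"
  shows "(step c' ^^ k) A = (step c ^^ k) A"
  using assms
proof (induction k arbitrary: A)
  case (Suc k)
  show ?case
  proof (cases A)
    case (Compare i j s d)
    have "(c i = c j) = (c' i = c' j)"
      using Suc.prems[of i j "c i = c j"] Compare by simp
    moreover have "(step c' ^^ k) (step c A) = (step c ^^ k) (step c A)"
      by (rule Suc.IH) (use Suc.prems Compare in auto)
    ultimately show ?thesis
      using Compare by (simp add: funpow_Suc_right del: funpow.simps)
  qed simp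
qed simp

subsection \<open>Merging colors along positive answers\<close>

text \<open>
  Starting from \<open>id\<close>, this is the finest coloring consistent with the answers \<open>h\<close>: the adversary
  coloring with the smallest color classes.
\<close>

fun glue :: "('b \<Rightarrow> 'b) \<Rightarrow> ('b \<times> 'b \<times> bool) list \<Rightarrow> 'b \<Rightarrow> 'b" where
  "glue f [] = f"
| "glue f ((i, j, e) # h) =
     glue (if e then (\<lambda>v. if f v = f i then f j else f v) else f) h"

lemma glue_eq: "f v = f w \<Longrightarrow> glue f h v = glue f h w"
  by (induction f h rule: glue.induct) auto

lemma glue_joins: "(i, j, True) \<in> set h \<Longrightarrow> glue f h i = glue f h j"
  by (induction f h rule: glue.induct) (auto intro: glue_eq)

lemma glue_step_refines:
  assumes ref: "\<And>v w. f v = f w \<Longrightarrow> c v = c w"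
    and e: "e \<longleftrightarrow> c i = c j"
    and eq: "(if e then (\<lambda>v. if f v = f i then f j else f v) else f) v =
      (if e then (\<lambda>v. if f v = f i then f j else f v) else f) w"
  shows "c v = c w"
  using eq e ref[of v i] ref[of w i] ref[of j w] ref[of v j] ref[of v w]
  by (simp split: if_splits)

text \<open>Each positive answer merges two classes of \<open>f\<close> that lie inside one class of
  \<open>c\<close>, so the partition stays finer than that of \<open>c\<close>.\<close>

lemma glue_refines:
  assumes "\<And>v w. f v = f w \<Longrightarrow> c v = c w"
    and "\<And>i j e. (i, j, e) \<in> set h \<Longrightarrow> e \<longleftrightarrow> c i = c j"
    and "glue f h v = glue f h w"
  shows "c v = c w"
  using assms
proof (induction f h rule: glue.induct)
  case (1 f)
  from "1.prems"(1)[OF "1.prems"(3)[unfolded glue.simps]] show ?case .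
next
  case (2 f i j e h)
  show ?case
  proof (rule "2.IH"[OF _ _ "2.prems"(3)[unfolded glue.simps]])
    fix v w
    assume eq: "(if e then (\<lambda>v. if f v = f i then f j else f v) else f) v =
      (if e then (\<lambda>v. if f v = f i then f j else f v) else f) w"
    have "e \<longleftrightarrow> c i = c j" using "2.prems"(2)[of i j e] by simp
    from glue_step_refines[OF "2.prems"(1) this eq] show "c v = c w" .
  next
    fix i' j' e' assume "(i', j', e') \<in> set h"
    then show "e' \<longleftrightarrow> c i' = c j'" using "2.prems"(2)[of i' j' e'] by simp
  qed
qed

text \<open>A positive answer destroys at most one value of \<open>f\<close> on \<open>W\<close>,
  and only if its balls lie in \<open>W\<close>. Gluing \<open>W\<close> from singletons into one
  class thus takes \<open>card W - 1\<close> positive answers inside \<open>W\<close>.\<close>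

lemma card_glue_image:
  assumes "finite U" and W: "W = {v \<in> U. c v = x}"
    and "\<And>v w. f v = f w \<Longrightarrow> c v = c w"
    and "\<And>i j e. (i, j, e) \<in> set h \<Longrightarrow> i \<in> U \<and> (e \<longleftrightarrow> c i = c j)"
  shows "card (f ` W) \<le> card (glue f h ` W) + length (filter (\<lambda>(i, j, e). e \<and> i \<in> W) h)"
  using assms(3,4)
proof (induction f h rule: glue.induct)
  case (1 f)
  show ?case by simp
next
  case (2 f i j e h)
  define g where "g = (if e then (\<lambda>v. if f v = f i then f j else f v) else f)"
  have fin: "finite W" using assms(1,2) by simp
  have e: "i \<in> U" "e \<longleftrightarrow> c i = c j" using "2.prems"(2)[of i j e] by simp_all
  have ref: "c v = c w" if "g v = g w" for v w
    by (rule glue_step_refines[OF "2.prems"(1) e(2) that[unfolded g_def]])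
  have IH: "card (g ` W) \<le> card (glue g h ` W) + length (filter (\<lambda>(i, j, e). e \<and> i \<in> W) h)"
    unfolding g_def
  proof (rule "2.IH")
    fix v w
    assume "(if e then (\<lambda>v. if f v = f i then f j else f v) else f) v =
      (if e then (\<lambda>v. if f v = f i then f j else f v) else f) w"
    then show "c v = c w" by (rule ref[unfolded g_def])
  next
    fix i' j' e' assume "(i', j', e') \<in> set h"
    then show "i' \<in> U \<and> (e' \<longleftrightarrow> c i' = c j')" using "2.prems"(2)[of i' j' e'] by simp
  qed
  have gl: "glue f ((i, j, e) # h) = glue g h" by (simp add: g_def)
  show ?case
  proof (cases "e \<and> i \<in> W")
    case True
    have "f ` W \<subseteq> insert (f i) (g ` W)" using True by (auto simp: g_def)
    then have "card (f ` W) \<le> card (insert (f i) (g ` W))"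
      using fin by (intro card_mono) auto
    also have "\<dots> \<le> Suc (card (g ` W))"
      using fin by (simp add: card_insert_if)
    finally show ?thesis using IH True unfolding gl by simp
  next
    case False
    \<comment> \<open>Either nothing is merged or the merge happens outside \<open>W\<close>: a ball
      of \<open>W\<close> sharing its class with \<open>i\<close> would put \<open>i\<close> into
      \<open>W\<close>.\<close>
    have "g ` W = f ` W"
    proof (rule image_cong[OF refl])
      fix v assume "v \<in> W"
      then show "g v = f v"
        using False e "2.prems"(1)[of v i] by (auto simp: g_def W)
    qed
    then show ?thesis using IH False unfolding gl by auto
  qed
qed

subsection \<open>Informative queries\<close>

text \<open>
  A set represents the two-coloring by membership; \<open>C\<close> contains the two-colorings consistent with
  the answers so far.
\<close>

fun links :: "'b set set \<Rightarrow> ('b \<times> 'b \<times> bool) list \<Rightarrow> ('b \<times> 'b \<times> bool) list" where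
  "links C [] = []"
| "links C ((i, j, e) # h) =
     (let C' = {T \<in> C. (i \<in> T \<longleftrightarrow> j \<in> T) = e}
      in if C' = C then links C h else (i, j, e) # links C' h)"

fun list_weight :: "(nat \<Rightarrow> bool \<Rightarrow> real) \<Rightarrow> nat \<Rightarrow> ('b \<times> 'b \<times> bool) list \<Rightarrow> real" where
  "list_weight a t [] = 0"
| "list_weight a t ((i, j, e) # l) = a t e + list_weight a (Suc t) l"

text \<open>
  Closure under the symmetric difference of three members makes the two answers to an informative
  query equally frequent in \<open>C\<close>.
\<close>

definition affine_family :: "'b set set \<Rightarrow> bool" where
  "affine_family C \<longleftrightarrow>
     (\<forall>S\<in>C. \<forall>T\<in>C. \<forall>R\<in>C. {v. (v \<in> S) \<noteq> ((v \<in> T) \<noteq> (v \<in> R))} \<in> C)"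

lemma links_subset: "set (links C h) \<subseteq> set h"
  by (induction C h rule: links.induct) (auto simp: Let_def)

lemma length_filter_links: "length (filter P (links C h)) \<le> length (filter P h)"
proof (induction h arbitrary: C)
  case (Cons q h)
  obtain i j e where q: "q = (i, j, e)" by (cases q)
  show ?case
    using Cons.IH[of C] Cons.IH[of "{T \<in> C. (i \<in> T \<longleftrightarrow> j \<in> T) = e}"]
    by (simp add: q Let_def)
qed simp

lemma affine_family_Pow: "affine_family (Pow U)"
  by (auto simp: affine_family_def)

text \<open>Separating \<open>i\<close> and \<open>j\<close> is additive modulo two under symmetric
  difference, and three equal bits sum to that same bit.\<close>

lemma affine_family_restrict:
  "affine_family C \<Longrightarrow> affine_family {T \<in> C. (i \<in> T \<longleftrightarrow> j \<in> T) = e}"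
  by (auto simp: affine_family_def)

text \<open>The symmetric difference with \<open>P\<close> and \<open>Q\<close> is an involution of
  \<open>C\<close>; as exactly one of them separates \<open>i\<close> from \<open>j\<close>, it
  exchanges the two halves.\<close>

lemma affine_family_halves:
  assumes aff: "affine_family C" and "finite C"
    and P: "P \<in> C" "i \<in> P \<longleftrightarrow> j \<in> P" and Q: "Q \<in> C" "\<not> (i \<in> Q \<longleftrightarrow> j \<in> Q)"
  shows "card {T \<in> C. (i \<in> T \<longleftrightarrow> j \<in> T) = True} = card {T \<in> C. (i \<in> T \<longleftrightarrow> j \<in> T) = False}"
proof -
  let ?f = "\<lambda>R. {v. (v \<in> P) \<noteq> ((v \<in> Q) \<noteq> (v \<in> R))}"
  have "?f R \<in> C" if "R \<in> C" for R
    using aff P Q that by (auto simp: affine_family_def)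
  then have "bij_betw ?f {T \<in> C. (i \<in> T \<longleftrightarrow> j \<in> T) = True} {T \<in> C. (i \<in> T \<longleftrightarrow> j \<in> T) = False}"
    by (intro bij_betw_byWitness[where f' = ?f]) (use P(2) Q(2) in auto)
  then show ?thesis by (rule bij_betw_same_card)
qed

text \<open>A supermartingale in counting form. An uninformative query changes neither
  \<open>C\<close> nor the weight; a link splits \<open>C\<close> into equal halves, and the
  hypothesis on \<open>a\<close> says that the mean factor of a fair coin is at most one.\<close>

lemma sum_exp_links_le:
  assumes a: "\<And>t. exp (a t True) + exp (a t False) \<le> 2"
    and "affine_family C" "finite C"
  shows "(\<Sum>S\<in>C. exp (list_weight a t (links C (transcript (two_coloring S) A k)))) \<le> card C"
  using assms(2,3)
proof (induction k arbitrary: A C t)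
  case (Suc k)
  show ?case
  proof (cases A)
    case (Compare i j s d)
    define C1 where "C1 = {T \<in> C. (i \<in> T \<longleftrightarrow> j \<in> T) = True}"
    define C0 where "C0 = {T \<in> C. (i \<in> T \<longleftrightarrow> j \<in> T) = False}"
    have aff: "affine_family C1" "affine_family C0"
      unfolding C1_def C0_def by (intro affine_family_restrict Suc.prems)+
    have fin: "finite C1" "finite C0" using Suc.prems by (auto simp: C1_def C0_def)
    have un: "C = C1 \<union> C0" "C1 \<inter> C0 = {}" by (auto simp: C1_def C0_def)
    let ?T = "\<lambda>S. list_weight a t (links C (transcript (two_coloring S) A (Suc k)))"
    have t1: "?T S = (if C1 = C then list_weight a t (links C (transcript (two_coloring S) s k))
       else a t True + list_weight a (Suc t) (links C1 (transcript (two_coloring S) s k)))"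
      if "S \<in> C1" for S
      using that Compare by (simp add: C1_def Let_def)
    have t0: "?T S = (if C0 = C then list_weight a t (links C (transcript (two_coloring S) d k))
       else a t False + list_weight a (Suc t) (links C0 (transcript (two_coloring S) d k)))"
      if "S \<in> C0" for S
      using that Compare by (simp add: C0_def Let_def)
    consider "C1 = C" | "C0 = C" | "C1 \<noteq> C" "C0 \<noteq> C" by blast
    then show ?thesis
    proof cases
      case 1
      then have "(\<Sum>S\<in>C. exp (?T S)) =
          (\<Sum>S\<in>C. exp (list_weight a t (links C (transcript (two_coloring S) s k))))"
        by (intro sum.cong refl) (use 1 t1 in \<open>simp del: transcript.simps\<close>)
      then show ?thesis using Suc.IH[OF Suc.prems] by simp
    next
      case 2
      then have "(\<Sum>S\<in>C. exp (?T S)) =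
          (\<Sum>S\<in>C. exp (list_weight a t (links C (transcript (two_coloring S) d k))))"
        by (intro sum.cong refl) (use 2 t0 in \<open>simp del: transcript.simps\<close>)
      then show ?thesis using Suc.IH[OF Suc.prems] by simp
    next
      case 3
      then obtain P Q where "P \<in> C1" "Q \<in> C0" using un by blast
      then have c: "card C1 = card C0" unfolding C1_def C0_def
        by (intro affine_family_halves[of C P i j Q] Suc.prems) auto
      have cC: "card C = card C1 + card C0"
        using un fin by (simp add: card_Un_disjoint)
      have "(\<Sum>S\<in>C. exp (?T S)) = (\<Sum>S\<in>C1. exp (?T S)) + (\<Sum>S\<in>C0. exp (?T S))"
        unfolding un(1) by (rule sum.union_disjoint) (use fin un(2) in auto)
      also have "(\<Sum>S\<in>C1. exp (?T S)) = exp (a t True) *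
          (\<Sum>S\<in>C1. exp (list_weight a (Suc t) (links C1 (transcript (two_coloring S) s k))))"
        unfolding sum_distrib_left by (intro sum.cong refl) (use 3 t1 in \<open>simp add: exp_add del: transcript.simps\<close>)
      also have "\<dots> \<le> exp (a t True) * card C1"
        by (intro mult_left_mono Suc.IH aff fin) auto
      also have "(\<Sum>S\<in>C0. exp (?T S)) = exp (a t False) *
          (\<Sum>S\<in>C0. exp (list_weight a (Suc t) (links C0 (transcript (two_coloring S) d k))))"
        unfolding sum_distrib_left by (intro sum.cong refl) (use 3 t0 in \<open>simp add: exp_add del: transcript.simps\<close>)
      also have "\<dots> \<le> exp (a t False) * card C0"
        by (intro mult_left_mono Suc.IH aff fin) auto
      also have "exp (a t True) * card C1 + exp (a t False) * card C0 =
          (exp (a t True) + exp (a t False)) * card C1"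
        by (simp add: c algebra_simps)
      also have "\<dots> \<le> 2 * real (card C1)" by (intro mult_right_mono a) auto
      also have "\<dots> = card C" by (simp add: cC c)
      finally show ?thesis by simp
    qed
  qed simp
qed simp

text \<open>Kraft's inequality, with the answers at links as binary codewords. A query that is no
  link has the same answer on all of \<open>C\<close>, so only links can tell members of
  \<open>Y\<close> apart.\<close>

lemma sum_links_kraft:
  assumes "finite C" "Y \<subseteq> C"
    and "inj_on (\<lambda>S. transcript (two_coloring S) A k) Y"
  shows "(\<Sum>S\<in>Y. (1/2::real) ^ length (links C (transcript (two_coloring S) A k))) \<le> 1"
  using assms
proof (induction k arbitrary: A C Y)
  case 0
  then have "card Y \<le> 1" by (simp add: inj_on_def card_le_Suc0_iff_eq finite_subset)
  then show ?case by simp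
next
  case (Suc k)
  have finY: "finite Y" using Suc.prems finite_subset by blast
  show ?case
  proof (cases A)
    case (Report r)
    then have "card Y \<le> 1"
      using Suc.prems(3) finY by (simp add: inj_on_def card_le_Suc0_iff_eq)
    then show ?thesis using Report by simp
  next
    case (Compare i j s d)
    define C1 where "C1 = {T \<in> C. (i \<in> T \<longleftrightarrow> j \<in> T) = True}"
    define C0 where "C0 = {T \<in> C. (i \<in> T \<longleftrightarrow> j \<in> T) = False}"
    define Y1 where "Y1 = Y \<inter> C1"
    define Y0 where "Y0 = Y \<inter> C0"
    have fin: "finite C1" "finite C0" using Suc.prems by (auto simp: C1_def C0_def)
    have un: "Y = Y1 \<union> Y0" "Y1 \<inter> Y0 = {}"
      using Suc.prems by (auto simp: C1_def C0_def Y1_def Y0_def)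
    have inj: "inj_on (\<lambda>S. transcript (two_coloring S) s k) Y1"
      "inj_on (\<lambda>S. transcript (two_coloring S) d k) Y0"
      using Suc.prems(3) Compare by (auto simp: inj_on_def Y1_def Y0_def C1_def C0_def)
    let ?T = "\<lambda>S. (1/2::real) ^ length (links C (transcript (two_coloring S) A (Suc k)))"
    have t1: "?T S = (if C1 = C then (1/2) ^ length (links C (transcript (two_coloring S) s k))
       else 1/2 * (1/2) ^ length (links C1 (transcript (two_coloring S) s k)))"
      if "S \<in> Y1" for S
      using that Compare by (simp add: C1_def Let_def Y1_def)
    have t0: "?T S = (if C0 = C then (1/2) ^ length (links C (transcript (two_coloring S) d k))
       else 1/2 * (1/2) ^ length (links C0 (transcript (two_coloring S) d k)))"
      if "S \<in> Y0" for S
      using that Compare by (simp add: C0_def Let_def Y0_def)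
    have split: "(\<Sum>S\<in>Y. ?T S) = (\<Sum>S\<in>Y1. ?T S) + (\<Sum>S\<in>Y0. ?T S)"
      unfolding un(1) by (rule sum.union_disjoint) (use finY un in auto)
    consider "C1 = C" | "C0 = C" | "C1 \<noteq> C" "C0 \<noteq> C" by blast
    then show ?thesis
    proof cases
      case 1
      then have "Y0 = {}" by (auto simp: Y0_def C0_def C1_def)
      then have "(\<Sum>S\<in>Y. ?T S) =
          (\<Sum>S\<in>Y1. (1/2) ^ length (links C1 (transcript (two_coloring S) s k)))"
        unfolding split using 1 by (simp add: t1 del: transcript.simps)
      also have "\<dots> \<le> 1" by (rule Suc.IH) (use fin inj Y1_def in auto)
      finally show ?thesis .
    next
      case 2
      then have "Y1 = {}" by (auto simp: Y1_def C0_def C1_def)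
      then have "(\<Sum>S\<in>Y. ?T S) =
          (\<Sum>S\<in>Y0. (1/2) ^ length (links C0 (transcript (two_coloring S) d k)))"
        unfolding split using 2 by (simp add: t0 del: transcript.simps)
      also have "\<dots> \<le> 1" by (rule Suc.IH) (use fin inj Y0_def in auto)
      finally show ?thesis .
    next
      case 3
      have "(\<Sum>S\<in>Y1. (1/2::real) ^ length (links C1 (transcript (two_coloring S) s k))) \<le> 1"
        by (rule Suc.IH) (use fin inj Y1_def in auto)
      moreover have "(\<Sum>S\<in>Y0. (1/2::real) ^ length (links C0 (transcript (two_coloring S) d k))) \<le> 1"
        by (rule Suc.IH) (use fin inj Y0_def in auto)
      ultimately show ?thesis
        unfolding split using 3
        by (simp add: t1 t0 del: transcript.simps flip: sum_divide_distrib)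
    qed
  qed
qed

subsection \<open>Recoloring untouched balls\<close>

definition avoiding :: "'b set \<Rightarrow> ('b \<times> 'b \<times> bool) list \<Rightarrow> ('b \<times> 'b \<times> bool) list" where
  "avoiding V = takeWhile (\<lambda>(i, j, e). i \<notin> V \<and> j \<notin> V)"

lemma avoiding_simps [simp]:
  "avoiding V [] = []"
  "avoiding V ((i, j, e) # l) = (if i \<in> V \<or> j \<in> V then [] else (i, j, e) # avoiding V l)"
  by (auto simp: avoiding_def)

lemma set_avoiding: "(i, j, e) \<in> set (avoiding V l) \<Longrightarrow> (i, j, e) \<in> set l \<and> i \<notin> V"
  by (induction l) (auto split: if_splits)

lemma length_filter_avoiding: "length (filter P (avoiding V l)) \<le> length (filter P l)"
  by (induction l) auto

text \<open>The two runs can first part only at a query answered differently by \<open>S\<close> and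
  \<open>S'\<close>. As both are still in \<open>C\<close>, that query is a link for either run, and
  it touches \<open>V\<close>, where both lists are cut off.\<close>

lemma avoiding_links_cong:
  assumes "set_algo A \<subseteq> U" "S \<in> C" "S' \<in> C"
    and "\<And>i j. \<lbrakk>i \<in> U; j \<in> U; (i \<in> S \<longleftrightarrow> j \<in> S) \<noteq> (i \<in> S' \<longleftrightarrow> j \<in> S')\<rbrakk> \<Longrightarrow> i \<in> V \<or> j \<in> V"
  shows "avoiding V (links C (transcript (two_coloring S) A k)) =
         avoiding V (links C (transcript (two_coloring S') A k))"
  using assms(1-3)
proof (induction k arbitrary: A C)
  case (Suc k)
  show ?case
  proof (cases A)
    case (Compare i j s d)
    let ?e = "i \<in> S \<longleftrightarrow> j \<in> S" and ?e' = "i \<in> S' \<longleftrightarrow> j \<in> S'"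
    have U: "i \<in> U" "j \<in> U" "set_algo s \<subseteq> U" "set_algo d \<subseteq> U"
      using Suc.prems Compare by auto
    define B where "B = (if ?e then s else d)"
    define D where "D = {T \<in> C. (i \<in> T \<longleftrightarrow> j \<in> T) = ?e}"
    have B: "set_algo B \<subseteq> U" using U by (simp add: B_def)
    have tr: "transcript (two_coloring S) A (Suc k) = (i, j, ?e) # transcript (two_coloring S) B k"
      using Compare by (simp add: B_def)
    show ?thesis
    proof (cases "?e = ?e'")
      case True
      have tr': "transcript (two_coloring S') A (Suc k) = (i, j, ?e) # transcript (two_coloring S') B k"
        using Compare True by (simp add: B_def)
      have "S \<in> D" "S' \<in> D" using Suc.prems True by (auto simp: D_def)
      note IH = Suc.IH[OF B this] and IH' = Suc.IH[OF B Suc.prems(2,3)]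
      show ?thesis unfolding tr tr' using IH IH'
        by (simp del: transcript.simps add: Let_def flip: D_def)
    next
      case False
      define D' where "D' = {T \<in> C. (i \<in> T \<longleftrightarrow> j \<in> T) = ?e'}"
      have tr': "transcript (two_coloring S') A (Suc k) =
          (i, j, ?e') # transcript (two_coloring S') (if ?e' then s else d) k"
        using Compare by simp
      have "D \<noteq> C" "D' \<noteq> C" using Suc.prems False by (auto simp: D_def D'_def)
      moreover have "i \<in> V \<or> j \<in> V" using assms(4)[of i j] U False by blast
      ultimately show ?thesis unfolding tr tr'
        by (simp del: transcript.simps add: Let_def flip: D_def D'_def)
    qed
  qed simp
qed simp

text \<open>\<open>R\<close> stands for the balls touched by the \<open>t\<close> earlier links. A
  positive link in position \<open>t\<close> is counted by every \<open>V\<close> avoiding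
  \<open>R\<close> and its own two balls; at least \<open>m - 2 * Suc t\<close> balls of
  \<open>W\<close> remain for choosing such a \<open>V\<close>.\<close>

lemma sum_avoiding_ge:
  assumes "finite W" "finite R" "card R \<le> 2 * t" "card W = m"
  shows "list_weight (\<lambda>t e. if e then real ((m - 2 * Suc t) choose k) else 0) t l \<le>
    (\<Sum>V | V \<subseteq> W - R \<and> card V = k. real (length (filter (\<lambda>(i, j, e). e) (avoiding V l))))"
  using assms(2,3)
proof (induction l arbitrary: R t)
  case (Cons q l)
  obtain i j e where q: "q = (i, j, e)" by (cases q)
  let ?K = "{V. V \<subseteq> W - R \<and> card V = k}" and ?K' = "{V. V \<subseteq> W - (R \<union> {i, j}) \<and> card V = k}"
  let ?L = "\<lambda>l V. real (length (filter (\<lambda>(i, j, e). e) (avoiding V l)))"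
  have fin: "finite ?K" "finite ?K'" using assms(1) by auto
  have "card (R \<union> {i, j}) \<le> card R + card {i, j}" by (rule card_Un_le)
  also have "card {i, j} \<le> 2" by (simp add: card_insert_if)
  finally have c: "card (R \<union> {i, j}) \<le> 2 * Suc t" using Cons.prems by simp
  have "m - 2 * Suc t \<le> card (W - (R \<union> {i, j}))"
    using diff_card_le_card_Diff[of "R \<union> {i, j}" W] c Cons.prems assms(4) by simp
  then have "(m - 2 * Suc t) choose k \<le> card (W - (R \<union> {i, j})) choose k"
    by (rule binomial_right_mono)
  also have "\<dots> = card ?K'" using assms(1) by (simp add: n_subsets)
  finally have f: "real ((m - 2 * Suc t) choose k) \<le> card ?K'" by simp
  have IH: "list_weight (\<lambda>t e. if e then real ((m - 2 * Suc t) choose k) else 0) (Suc t) l \<le>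
      (\<Sum>V\<in>?K'. ?L l V)"
    using Cons.IH[of "R \<union> {i, j}" "Suc t"] c Cons.prems by simp
  have "(if e then real ((m - 2 * Suc t) choose k) else 0) \<le> (\<Sum>V\<in>?K'. if e then 1 else 0)"
    using f by simp
  then have "list_weight (\<lambda>t e. if e then real ((m - 2 * Suc t) choose k) else 0) t (q # l) \<le>
      (\<Sum>V\<in>?K'. (if e then 1 else 0) + ?L l V)"
    using IH by (simp add: q sum.distrib del: sum_constant)
  also have "\<dots> = (\<Sum>V\<in>?K'. ?L (q # l) V)"
    by (intro sum.cong) (auto simp: q)
  also have "\<dots> \<le> (\<Sum>V\<in>?K. ?L (q # l) V)"
    by (intro sum_mono2 fin) auto
  finally show ?case .
qed simp

subsection \<open>Runs on two-colorings with a minimal majority\<close>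

definition majority_sets :: "nat \<Rightarrow> nat set set" where
  "majority_sets n = {W. W \<subseteq> {1..n} \<and> card W = Suc (n div 2)}"

text \<open>The excess of a minimal majority over its complement: one for odd \<open>n\<close>, two
  for even \<open>n\<close>.\<close>

definition surplus :: "nat \<Rightarrow> nat" where
  "surplus n = 2 * Suc (n div 2) - n"

lemma length_eq_filters:
  "length h = length (filter (\<lambda>(i, j, e). e \<and> i \<in> W) h) +
     length (filter (\<lambda>(i, j, e). e \<and> i \<notin> W) h) + length (filter (\<lambda>(i, j, e). \<not> e) h)"
  by (induction h) auto

lemma length_filter_complementary:
  assumes "\<And>i j e. (i, j, e) \<in> set l \<Longrightarrow> i \<in> W \<longleftrightarrow> i \<notin> W'"
  shows "length (filter (\<lambda>(i, j, e). e \<and> i \<notin> W) l) +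
     length (filter (\<lambda>(i, j, e). e \<and> i \<notin> W') l) = length (filter (\<lambda>(i, j, e). e) l)"
  using assms
proof (induction l)
  case (Cons q l)
  obtain i j e where q: "q = (i, j, e)" by (cases q)
  have "i \<in> W \<longleftrightarrow> i \<notin> W'" using Cons.prems[of i j e] by (simp add: q)
  moreover have "length (filter (\<lambda>(i, j, e). e \<and> i \<notin> W) l) +
     length (filter (\<lambda>(i, j, e). e \<and> i \<notin> W') l) = length (filter (\<lambda>(i, j, e). e) l)"
    by (rule Cons.IH) (use Cons.prems in \<open>meson list.set_intros(2)\<close>)
  ultimately show ?case by (simp add: q)
qed simp

lemma finite_majority_sets: "finite (majority_sets n)"
  by (simp add: majority_sets_def)

lemma card_majority_sets: "card (majority_sets n) = n choose Suc (n div 2)"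
  using n_subsets[of "{1..n}" "Suc (n div 2)"] by (simp add: majority_sets_def)

text \<open>One cutoff \<open>K\<close> is enough because there are finitely many minimal
  majorities. On other colorings only the correctness of a report, if any, is assumed.\<close>

locale exact_solver =
  fixes n :: nat and A :: "nat algo" and K :: nat
  assumes balls: "set_algo A \<subseteq> {1..n}"
    and correct: "\<And>(c :: nat \<Rightarrow> nat) k r. reports_after c A k r \<Longrightarrow> correct_report n c r"
    and halted: "\<And>W. W \<in> majority_sets n \<Longrightarrow> \<exists>r. reports_after (two_coloring W) A K r"
begin

abbreviation run :: "nat set \<Rightarrow> (nat \<times> nat \<times> bool) list" where
  "run W \<equiv> transcript (two_coloring W) A K"

abbreviation run_links :: "nat set \<Rightarrow> (nat \<times> nat \<times> bool) list" where
  "run_links W \<equiv> links (Pow {1..n}) (run W)"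

lemma run_links_balls: "(i, j, e) \<in> set (run_links W) \<Longrightarrow> i \<in> {1..n}"
  using links_subset[of "Pow {1..n}" "run W"] transcript_balls[of i j e] balls by blast

lemma glue_run_refines:
  assumes "glue id (run W) v = glue id (run W) w"
  shows "two_coloring W v = two_coloring W w"
proof (rule glue_refines[OF _ _ assms])
  show "two_coloring W v = two_coloring W w" if "id v = id w" for v w
    using that by simp
  show "e \<longleftrightarrow> two_coloring W i = two_coloring W j" if "(i, j, e) \<in> set (run W)" for i j e
    using that by (rule transcript_answers)
qed

text \<open>Adversary argument: the glued coloring fits the transcript, so the same ball
  \<open>b\<close> is reported and its glued class must have more than \<open>n div 2\<close> balls.
  That class lies inside \<open>W\<close>, which is no larger.\<close>

lemma report_is_glued_class:
  assumes "W \<in> majority_sets n"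
  obtains b where "(step (two_coloring W) ^^ K) A = Report (Some b)"
    and "W = {v \<in> {1..n}. glue id (run W) v = glue id (run W) b}"
proof -
  have W: "W \<subseteq> {1..n}" "card W = Suc (n div 2)" using assms by (auto simp: majority_sets_def)
  let ?g = "glue id (run W)"
  obtain r where r: "reports_after (two_coloring W) A K r" using halted[OF assms] by blast
  have one: "{v \<in> {1..n}. two_coloring W v = 1} = W" using W by auto
  have zero: "{v \<in> {1..n}. two_coloring W v = 0} = {1..n} - W" by auto
  have "majority_color n (two_coloring W) 1"
    unfolding majority_color_def one using W by simp
  then obtain b where b: "r = Some b" "b \<in> {1..n}"
      "majority_color n (two_coloring W) (two_coloring W b)"
    using correct[OF r] unfolding correct_report_def by (auto split: option.splits)
  have "\<not> majority_color n (two_coloring W) 0"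
    unfolding majority_color_def zero using W by (simp add: card_Diff_subset finite_subset)
  then have "b \<in> W" using b(3) by (cases "b \<in> W") auto
  \<comment> \<open>Positive answers hold by gluing, negative ones because glued balls agree in the
    two-coloring.\<close>
  have ans: "e \<longleftrightarrow> ?g i = ?g j" if "(i, j, e) \<in> set (run W)" for i j e
    using transcript_answers[OF that] glue_joins[of i j "run W" id] glue_run_refines[of W i j] that
    by (cases e) metis+
  have "(step ?g ^^ K) A = (step (two_coloring W) ^^ K) A"
    by (rule funpow_step_cong) (rule ans)
  then have "reports_after ?g A K (Some b)" using r b(1) by (simp add: reports_after_def)
  then have "majority_color n ?g (?g b)"
    using correct by (fastforce simp: correct_report_def)
  then have c: "card W \<le> card {v \<in> {1..n}. ?g v = ?g b}"
    using W by (simp add: majority_color_def)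
  have sub: "{v \<in> {1..n}. ?g v = ?g b} \<subseteq> W"
  proof
    fix v assume "v \<in> {v \<in> {1..n}. ?g v = ?g b}"
    then have "?g v = ?g b" by simp
    have "two_coloring W v = two_coloring W b"
      by (rule glue_run_refines) fact
    then show "v \<in> W" using \<open>b \<in> W\<close> by (simp add: of_bool_def split: if_splits)
  qed
  have "{v \<in> {1..n}. ?g v = ?g b} = W"
    using card_seteq[OF _ sub c] W finite_subset by blast
  then show thesis using that r b(1) by (auto simp: reports_after_def)
qed

text \<open>The transcript determines the report and the gluing, hence \<open>W\<close> as the glued
  class of the reported ball. This injectivity feeds Kraft's inequality.\<close>

lemma inj_on_run: "inj_on run (majority_sets n)"
proof (rule inj_onI)
  fix W W' assume W: "W \<in> majority_sets n" "W' \<in> majority_sets n" and eq: "run W = run W'"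
  obtain b where b: "(step (two_coloring W) ^^ K) A = Report (Some b)"
    "W = {v \<in> {1..n}. glue id (run W) v = glue id (run W) b}"
    using report_is_glued_class[OF W(1)] .
  obtain b' where b': "(step (two_coloring W') ^^ K) A = Report (Some b')"
    "W' = {v \<in> {1..n}. glue id (run W') v = glue id (run W') b'}"
    using report_is_glued_class[OF W(2)] .
  have "(step (two_coloring W') ^^ K) A = (step (two_coloring W) ^^ K) A"
  proof (rule funpow_step_cong)
    fix i j e assume "(i, j, e) \<in> set (run W)"
    then have "(i, j, e) \<in> set (run W')" by (simp only: eq)
    then show "e \<longleftrightarrow> two_coloring W' i = two_coloring W' j" by (rule transcript_answers)
  qed
  then have "b = b'" using b(1) b'(1) by simp
  then show "W = W'" using b(2) b'(2) eq by metis
qed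

text \<open>Gluing \<open>W\<close> into a single class takes \<open>n div 2\<close> positive
  answers inside \<open>W\<close>. Negative answers and positive answers in the minority are counted
  only at links.\<close>

lemma length_run_ge:
  assumes "W \<in> majority_sets n"
  shows "n div 2 + length (filter (\<lambda>(i, j, e). \<not> e) (run_links W)) +
    length (filter (\<lambda>(i, j, e). e \<and> i \<notin> W) (run_links W)) \<le> length (run W)"
proof -
  let ?g = "glue id (run W)"
  have W: "W \<subseteq> {1..n}" "card W = Suc (n div 2)" using assms by (auto simp: majority_sets_def)
  obtain b where b: "W = {v \<in> {1..n}. ?g v = ?g b}"
    using report_is_glued_class[OF assms] .
  have "?g ` W \<subseteq> {?g b}" using b by blast
  then have "card (?g ` W) \<le> 1" using card_mono[of "{?g b}"] by simp
  moreover have "card (id ` W) \<le> card (?g ` W) + length (filter (\<lambda>(i, j, e). e \<and> i \<in> W) (run W))"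
  proof (rule card_glue_image[where U = "{1..n}" and x = 1])
    show "W = {v \<in> {1..n}. two_coloring W v = 1}" using W by auto
    fix i j e assume q: "(i, j, e) \<in> set (run W)"
    show "i \<in> {1..n} \<and> (e \<longleftrightarrow> two_coloring W i = two_coloring W j)"
      using transcript_balls[OF q] balls transcript_answers[OF q] by (intro conjI) blast
  qed simp_all
  ultimately show ?thesis
    using W(2) length_eq_filters[of "run W" W]
      length_filter_links[of "\<lambda>(i, j, e). \<not> e" "Pow {1..n}" "run W"]
      length_filter_links[of "\<lambda>(i, j, e). e \<and> i \<notin> W" "Pow {1..n}" "run W"]
    by simp
qed

text \<open>Outside \<open>V\<close> the flip exchanges majority and minority without changing any
  answer, so each positive link before \<open>V\<close> is touched lies in the minority of exactly
  one of the two colorings.\<close>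

lemma flip_majority:
  assumes "W \<in> majority_sets n" "V \<subseteq> W" "card V = surplus n"
  shows "({1..n} - W) \<union> V \<in> majority_sets n"
    and "avoiding V (run_links (({1..n} - W) \<union> V)) = avoiding V (run_links W)"
    and "length (filter (\<lambda>(i, j, e). e \<and> i \<notin> W) (avoiding V (run_links W))) +
      length (filter (\<lambda>(i, j, e). e \<and> i \<notin> ({1..n} - W) \<union> V)
        (avoiding V (run_links (({1..n} - W) \<union> V)))) =
      length (filter (\<lambda>(i, j, e). e) (avoiding V (run_links W)))"
proof -
  have W: "W \<subseteq> {1..n}" "card W = Suc (n div 2)" using assms by (auto simp: majority_sets_def)
  have fin: "finite W" using W(1) by (rule finite_subset) simp
  then have finV: "finite V" using assms(2) by (rule finite_subset[rotated])
  have "card W \<le> card {1..n}" by (rule card_mono) (use W in auto)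
  then have "Suc (n div 2) \<le> n" using W by simp
  have "card (({1..n} - W) \<union> V) = (n - Suc (n div 2)) + surplus n"
    using W assms fin finV by (subst card_Un_disjoint) (auto simp: card_Diff_subset)
  also have "\<dots> = Suc (n div 2)" using \<open>Suc (n div 2) \<le> n\<close> unfolding surplus_def by presburger
  finally show "({1..n} - W) \<union> V \<in> majority_sets n"
    using W assms(2) by (auto simp: majority_sets_def)
  show eq: "avoiding V (run_links (({1..n} - W) \<union> V)) = avoiding V (run_links W)"
    by (rule avoiding_links_cong[OF balls]) (use W assms(2) in auto)
  show "length (filter (\<lambda>(i, j, e). e \<and> i \<notin> W) (avoiding V (run_links W))) +
      length (filter (\<lambda>(i, j, e). e \<and> i \<notin> ({1..n} - W) \<union> V)
        (avoiding V (run_links (({1..n} - W) \<union> V)))) =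
      length (filter (\<lambda>(i, j, e). e) (avoiding V (run_links W)))"
    unfolding eq
  proof (rule length_filter_complementary)
    fix i j e assume "(i, j, e) \<in> set (avoiding V (run_links W))"
    from set_avoiding[OF this] have "i \<notin> V" "i \<in> {1..n}" by (simp, blast intro: run_links_balls)
    then show "i \<in> W \<longleftrightarrow> i \<notin> ({1..n} - W) \<union> V" by blast
  qed
qed

text \<open>Double counting of pairs \<open>(W, V)\<close>: the flip is an involution on them, so in
  total half of the positive links made before \<open>V\<close> is touched lie in the
  minority.\<close>

lemma sum_minority_links_ge:
  "(\<Sum>W\<in>majority_sets n. list_weight
      (\<lambda>t e. if e then real ((Suc (n div 2) - 2 * Suc t) choose surplus n) else 0) 0 (run_links W)) \<le>
   2 * real (Suc (n div 2) choose surplus n) *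
     (\<Sum>W\<in>majority_sets n. real (length (filter (\<lambda>(i, j, e). e \<and> i \<notin> W) (run_links W))))"
proof -
  let ?X = "majority_sets n" and ?m = "Suc (n div 2)" and ?k = "surplus n"
  let ?V = "\<lambda>W. {V. V \<subseteq> W \<and> card V = ?k}"
  let ?P = "Sigma ?X ?V"
  let ?E = "\<lambda>(W, V). real (length (filter (\<lambda>(i, j, e). e \<and> i \<notin> W) (avoiding V (run_links W))))"
  let ?F = "\<lambda>(W, V). real (length (filter (\<lambda>(i, j, e). e) (avoiding V (run_links W))))"
  let ?\<phi> = "\<lambda>(W, V). (({1..n} - W) \<union> V, V)"
  have X: "W \<subseteq> {1..n}" "finite W" "card W = ?m" if "W \<in> ?X" for W
    using that finite_subset by (auto simp: majority_sets_def)
  have finV: "finite (?V W)" if "W \<in> ?X" for W using X(2)[OF that] by simp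
  have bij: "bij_betw ?\<phi> ?P ?P"
  proof (rule bij_betw_byWitness[where f' = ?\<phi>])
    show "?\<phi> ` ?P \<subseteq> ?P" using flip_majority(1) by auto
    then show "?\<phi> ` ?P \<subseteq> ?P" .
    show "\<forall>p\<in>?P. ?\<phi> (?\<phi> p) = p" using X(1) by fastforce
    then show "\<forall>p\<in>?P. ?\<phi> (?\<phi> p) = p" .
  qed
  have "(\<Sum>W\<in>?X. list_weight (\<lambda>t e. if e then real ((?m - 2 * Suc t) choose ?k) else 0) 0 (run_links W))
      \<le> (\<Sum>W\<in>?X. \<Sum>V\<in>?V W. ?F (W, V))"
  proof (rule sum_mono)
    fix W assume "W \<in> ?X"
    then show "list_weight (\<lambda>t e. if e then real ((?m - 2 * Suc t) choose ?k) else 0) 0 (run_links W)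
        \<le> (\<Sum>V\<in>?V W. ?F (W, V))"
      using sum_avoiding_ge[of W "{}" 0 ?m ?k "run_links W"] X[of W] by simp
  qed
  also have "\<dots> = (\<Sum>p\<in>?P. ?F p)"
    by (subst sum.Sigma) (use finite_majority_sets finV in auto)
  also have "\<dots> = (\<Sum>p\<in>?P. ?E p + ?E (?\<phi> p))"
  proof (rule sum.cong[OF refl])
    fix p assume "p \<in> ?P"
    then obtain W V where p: "p = (W, V)" "W \<in> ?X" "V \<subseteq> W" "card V = ?k" by auto
    from flip_majority(3)[OF p(2-4), THEN arg_cong[where f = real]]
    show "?F p = ?E p + ?E (?\<phi> p)" by (simp add: p(1))
  qed
  also have "\<dots> = (\<Sum>p\<in>?P. ?E p) + (\<Sum>p\<in>?P. ?E (?\<phi> p))" by (rule sum.distrib)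
  also have "(\<Sum>p\<in>?P. ?E (?\<phi> p)) = (\<Sum>p\<in>?P. ?E p)" by (rule sum.reindex_bij_betw[OF bij])
  also have "(\<Sum>p\<in>?P. ?E p) = (\<Sum>W\<in>?X. \<Sum>V\<in>?V W. ?E (W, V))"
    by (subst sum.Sigma) (use finite_majority_sets finV in auto)
  \<comment> \<open>Dropping the truncation removes the dependence on \<open>V\<close>; each
    \<open>W\<close> then occurs once per choice of \<open>V\<close>.\<close>
  also have "\<dots> \<le> (\<Sum>W\<in>?X. \<Sum>V\<in>?V W. real (length (filter (\<lambda>(i, j, e). e \<and> i \<notin> W) (run_links W))))"
    by (intro sum_mono) (simp add: length_filter_avoiding)
  also have "\<dots> = real (?m choose ?k) *
      (\<Sum>W\<in>?X. real (length (filter (\<lambda>(i, j, e). e \<and> i \<notin> W) (run_links W))))"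
    unfolding sum_distrib_left using X by (intro sum.cong) (simp_all add: n_subsets)
  finally show ?thesis by simp
qed

end

subsection \<open>Concentration and asymptotics\<close>

lemma list_weight_linear:
  "list_weight (\<lambda>t e. x * a t e + y * b t e) t l = x * list_weight a t l + y * list_weight b t l"
  by (induction a t l rule: list_weight.induct) (auto simp: algebra_simps)

lemma list_weight_const: "list_weight (\<lambda>t e. a t) t l = (\<Sum>u<length l. a (t + u))"
proof (induction l arbitrary: t)
  case (Cons q l)
  obtain i j e where "q = (i, j, e)" by (cases q)
  then show ?case using Cons.IH[of "Suc t"] by (simp add: sum.lessThan_Suc_shift del: sum.lessThan_Suc)
qed simp

lemma list_weight_False:
  "list_weight (\<lambda>t e. if e then 0 else 1) t l = length (filter (\<lambda>(i, j, e). \<not> e) l)"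
  by (induction "\<lambda>(t::nat) e. if e then (0::real) else 1" t l rule: list_weight.induct) auto

text \<open>
  A lower bound for the probability that the first \<open>t + 1\<close> links avoid a random \<open>V \<subseteq> W\<close> with
  \<open>card V = surplus n\<close>. The truncated subtraction gives \<open>0\<close> once they may touch all of \<open>W\<close>.
\<close>

definition avoid_prob :: "nat \<Rightarrow> nat \<Rightarrow> real" where
  "avoid_prob n t = real ((Suc (n div 2) - 2 * Suc t) choose surplus n) /
     real (Suc (n div 2) choose surplus n)"

text \<open>A lower estimate, on average over the flips, of what a link adds to the cost beyond
  \<open>n div 2\<close>. A positive link counts half because only half of those preceding the first
  touch of \<open>V\<close> lie in the minority.\<close>

definition gain :: "nat \<Rightarrow> nat \<Rightarrow> bool \<Rightarrow> real" where
  "gain n t e = (if e then avoid_prob n t / 2 else 1)"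

text \<open>Mean of \<open>gain\<close> when the answer is a fair coin.\<close>

definition mean_gain :: "nat \<Rightarrow> nat \<Rightarrow> real" where
  "mean_gain n t = (1 + avoid_prob n t / 2) / 2"

lemma surplus_le: "n > 0 \<Longrightarrow> surplus n \<le> Suc (n div 2)"
  unfolding surplus_def by presburger

lemma avoid_prob_bounds: "n > 0 \<Longrightarrow> 0 \<le> avoid_prob n t \<and> avoid_prob n t \<le> 1"
  using binomial_right_mono[of "Suc (n div 2) - 2 * Suc t" "Suc (n div 2)" "surplus n"] surplus_le[of n]
  by (simp add: avoid_prob_def divide_le_eq)

lemma exp_minus_le: "0 \<le> (a::real) \<Longrightarrow> exp (- a) \<le> 1 - a + a\<^sup>2 / 2"
proof -
  assume a: "0 \<le> a"
  let ?f = "\<lambda>x::real. 1 - x + x\<^sup>2 / 2 - exp (- x)"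
  have "?f 0 \<le> ?f a"
  proof (rule DERIV_nonneg_imp_nondecreasing[OF a])
    fix x :: real assume "0 \<le> x"
    have "(?f has_real_derivative (- 1 + x + exp (- x))) (at x)"
      by (auto intro!: derivative_eq_intros)
    moreover have "0 \<le> - 1 + x + exp (- x)" using exp_ge_add_one_self[of "- x"] by simp
    ultimately show "\<exists>y. (?f has_real_derivative y) (at x) \<and> 0 \<le> y" by blast
  qed
  then show ?thesis by simp
qed

text \<open>The hypothesis of \<open>sum_exp_links_le\<close> for the deviation of
  \<open>gain\<close> from its mean; \<open>\<delta>\<^sup>2 / 2\<close> pays for the second-order
  term of the exponential. The factors \<open>1\<close> and \<open>- \<delta>\<close> match
  \<open>list_weight_linear\<close>.\<close>

lemma exp_gain_le:
  assumes "0 \<le> \<delta>" "n > 0"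
  shows "exp (1 * (\<delta> * mean_gain n t - \<delta>\<^sup>2 / 2) + (- \<delta>) * gain n t True) +
    exp (1 * (\<delta> * mean_gain n t - \<delta>\<^sup>2 / 2) + (- \<delta>) * gain n t False) \<le> 2"
proof -
  define p where "p = avoid_prob n t / 2"
  have p: "0 \<le> p" "p \<le> 1" using avoid_prob_bounds[OF assms(2), of t] by (auto simp: p_def)
  have "exp (- (\<delta> * p)) \<le> 1 - \<delta> * p + (\<delta> * p)\<^sup>2 / 2"
    using assms p by (intro exp_minus_le) simp
  moreover have "(\<delta> * p)\<^sup>2 \<le> \<delta>\<^sup>2"
    using assms p by (intro power_mono mult_left_le) auto
  moreover have "exp (- \<delta>) \<le> 1 - \<delta> + \<delta>\<^sup>2 / 2" using assms by (intro exp_minus_le)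
  ultimately have "exp (- (\<delta> * p)) + exp (- \<delta>) \<le> 2 * (1 + (- \<delta> * ((1 + p) / 2) + \<delta>\<^sup>2 / 2))"
    by (simp add: field_simps)
  also have "\<dots> \<le> 2 * exp (- \<delta> * ((1 + p) / 2) + \<delta>\<^sup>2 / 2)"
    by (intro mult_left_mono exp_ge_add_one_self) simp
  finally have *: "exp (- (\<delta> * p)) + exp (- \<delta>) \<le> 2 * exp (- \<delta> * ((1 + p) / 2) + \<delta>\<^sup>2 / 2)" .
  define q where "q = \<delta> * ((1 + p) / 2) - \<delta>\<^sup>2 / 2"
  have "exp q * (exp (- (\<delta> * p)) + exp (- \<delta>)) \<le> exp q * (2 * exp (- q))"
    using * by (intro mult_left_mono) (simp_all add: q_def)
  also have "\<dots> = 2" by (simp flip: exp_add)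
  finally have "exp (q + - (\<delta> * p)) + exp (q + - \<delta>) \<le> 2"
    by (simp only: exp_add distrib_left)
  moreover have "1 * (\<delta> * mean_gain n t - \<delta>\<^sup>2 / 2) + (- \<delta>) * gain n t True = q + - (\<delta> * p)"
    by (simp add: gain_def mean_gain_def q_def p_def)
  moreover have "1 * (\<delta> * mean_gain n t - \<delta>\<^sup>2 / 2) + (- \<delta>) * gain n t False = q + - \<delta>"
    by (simp add: gain_def mean_gain_def q_def p_def)
  ultimately show ?thesis by (simp only:)
qed

context exact_solver
begin

lemma sum_length_run_ge:
  assumes "n > 0"
  shows "(\<Sum>W\<in>majority_sets n. real (n div 2) + list_weight (gain n) 0 (run_links W)) \<le>
    (\<Sum>W\<in>majority_sets n. real (length (run W)))"
proof -
  let ?X = "majority_sets n" and ?m = "Suc (n div 2)" and ?k = "surplus n"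
  let ?M = "real (?m choose ?k)"
  let ?c = "\<lambda>t e. if e then real ((?m - 2 * Suc t) choose ?k) else 0"
  let ?D = "\<lambda>W. real (length (filter (\<lambda>(i, j, e). \<not> e) (run_links W)))"
  let ?E = "\<lambda>W. real (length (filter (\<lambda>(i, j, e). e \<and> i \<notin> W) (run_links W)))"
  have M: "?M > 0" using surplus_le[OF assms] by simp
  have "gain n = (\<lambda>t e. 1 * (if e then 0 else 1) + 1 / (2 * ?M) * ?c t e)"
    by (auto simp: gain_def avoid_prob_def fun_eq_iff)
  then have g: "list_weight (gain n) 0 l = real (length (filter (\<lambda>(i, j, e). \<not> e) l)) +
      1 / (2 * ?M) * list_weight ?c 0 l" for l :: "(nat \<times> nat \<times> bool) list"
    by (simp only: list_weight_linear list_weight_False)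
  have "(\<Sum>W\<in>?X. real (n div 2) + list_weight (gain n) 0 (run_links W)) =
      (\<Sum>W\<in>?X. real (n div 2) + ?D W) + 1 / (2 * ?M) * (\<Sum>W\<in>?X. list_weight ?c 0 (run_links W))"
    by (simp only: g sum.distrib sum_distrib_left add.assoc)
  also have "\<dots> \<le> (\<Sum>W\<in>?X. real (n div 2) + ?D W) + 1 / (2 * ?M) * (2 * ?M * (\<Sum>W\<in>?X. ?E W))"
    by (intro add_left_mono mult_left_mono sum_minority_links_ge) simp
  also have "\<dots> = (\<Sum>W\<in>?X. real (n div 2) + ?D W + ?E W)"
    using M by (simp add: sum.distrib)
  also have "\<dots> \<le> (\<Sum>W\<in>?X. real (length (run W)))"
    by (intro sum_mono) (use length_run_ge in \<open>simp flip: of_nat_add\<close>)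
  finally show ?thesis .
qed

text \<open>
  The two subtracted terms bound the number of runs violating the exponential tail bound and, by
  Kraft's inequality, of those with fewer than \<open>L\<close> links.
\<close>

lemma sum_gain_ge:
  fixes \<delta> \<eta> :: real
  assumes "n > 0" "0 < \<delta>" "\<delta> \<le> 1"
    and B: "B = (\<Sum>t<L. mean_gain n t) - \<delta> * L / 2 - \<eta> / \<delta>" "0 \<le> B"
  shows "(real (card (majority_sets n)) - 2 ^ n * exp (- \<eta>) - 2 ^ L) * B \<le>
    (\<Sum>W\<in>majority_sets n. list_weight (gain n) 0 (run_links W))"
proof -
  let ?X = "majority_sets n" and ?G = "\<lambda>W. list_weight (gain n) 0 (run_links W)"
  define \<mu> where "\<mu> t = \<delta> * mean_gain n t - \<delta>\<^sup>2 / 2" for t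
  define Z where "Z W = (\<Sum>t<length (run_links W). \<mu> t) - \<delta> * ?G W" for W
  have Z: "list_weight (\<lambda>t e. 1 * \<mu> t + (- \<delta>) * gain n t e) 0 (run_links W) = Z W" for W
    unfolding list_weight_linear list_weight_const by (simp add: Z_def)
  \<comment> \<open>Nonnegativity makes the partial sums of \<open>\<mu>\<close> monotone, so links
    beyond the first \<open>L\<close> can only help.\<close>
  have mu0: "0 \<le> \<mu> t" for t
  proof -
    have "\<delta>\<^sup>2 \<le> \<delta>" using assms by (simp add: power2_eq_square mult_left_le)
    also have "\<delta> \<le> 2 * (\<delta> * mean_gain n t)"
      using assms avoid_prob_bounds[OF assms(1), of t] by (simp add: mean_gain_def)
    finally show ?thesis by (simp add: \<mu>_def)
  qed
  define X1 where "X1 = {W \<in> ?X. \<eta> \<le> Z W}"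
  define X2 where "X2 = {W \<in> ?X. length (run_links W) < L}"
  have fin: "finite ?X" "finite X1" "finite X2"
    using finite_majority_sets by (auto simp: X1_def X2_def)
  have "card X1 * exp \<eta> = (\<Sum>W\<in>X1. exp \<eta>)" by simp
  also have "\<dots> \<le> (\<Sum>W\<in>X1. exp (Z W))" by (intro sum_mono) (simp add: X1_def)
  \<comment> \<open>Passing to all two-colorings, where links are fair coins, costs only the ratio
    of \<open>2 ^ n\<close> to the number of majority sets.\<close>
  also have "\<dots> \<le> (\<Sum>W\<in>Pow {1..n}. exp (Z W))"
    by (intro sum_mono2) (auto simp: X1_def majority_sets_def)
  also have "\<dots> \<le> card (Pow {1..n})"
    unfolding Z[symmetric]
    by (intro sum_exp_links_le affine_family_Pow)
      (use exp_gain_le[of \<delta> n] assms in \<open>auto simp: \<mu>_def\<close>)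
  also have "\<dots> = 2 ^ n" by (simp add: card_Pow)
  finally have c1: "card X1 \<le> 2 ^ n * exp (- \<eta>)" by (simp add: exp_minus field_simps)
  have "card X2 * (1/2) ^ L = (\<Sum>W\<in>X2. (1/2::real) ^ L)" by simp
  also have "\<dots> \<le> (\<Sum>W\<in>X2. (1/2) ^ length (run_links W))"
    by (intro sum_mono power_decreasing) (auto simp: X2_def)
  also have "\<dots> \<le> 1"
    by (rule sum_links_kraft)
      (use inj_on_run in \<open>auto simp: X2_def majority_sets_def elim: inj_on_subset\<close>)
  finally have c2: "card X2 \<le> (2::real) ^ L" by (simp add: power_one_over field_simps)
  have G0: "0 \<le> ?G W" for W
  proof -
    have "0 \<le> list_weight (gain n) t l" for t and l :: "(nat \<times> nat \<times> bool) list"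
      using avoid_prob_bounds[OF assms(1)]
      by (induction "gain n" t l rule: list_weight.induct) (auto simp: gain_def)
    then show ?thesis .
  qed
  have G: "B \<le> ?G W" if "W \<in> ?X - (X1 \<union> X2)" for W
  proof -
    have "\<delta> * B = (\<Sum>t<L. \<mu> t) - \<eta>"
      using assms(2)
      by (simp add: B \<mu>_def sum_subtractf sum_distrib_left power2_eq_square algebra_simps)
    also have "(\<Sum>t<L. \<mu> t) \<le> (\<Sum>t<length (run_links W). \<mu> t)"
      by (intro sum_mono2) (use that mu0 in \<open>auto simp: X2_def\<close>)
    also have "(\<Sum>t<length (run_links W). \<mu> t) - \<eta> \<le> \<delta> * ?G W"
      using that by (auto simp: X1_def Z_def)
    finally show ?thesis using assms(2) by simp
  qed
  have "card ?X \<le> card (?X - (X1 \<union> X2)) + card (X1 \<union> X2)"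
    using diff_card_le_card_Diff[of "X1 \<union> X2" ?X] fin by simp
  also have "\<dots> \<le> card (?X - (X1 \<union> X2)) + (card X1 + card X2)"
    by (intro add_left_mono card_Un_le)
  finally have "real (card ?X) - 2 ^ n * exp (- \<eta>) - 2 ^ L \<le> card (?X - (X1 \<union> X2))"
    using c1 c2 by linarith
  then have "(real (card ?X) - 2 ^ n * exp (- \<eta>) - 2 ^ L) * B \<le> card (?X - (X1 \<union> X2)) * B"
    by (intro mult_right_mono B)
  also have "\<dots> = (\<Sum>W\<in>?X - (X1 \<union> X2). B)" by simp
  also have "\<dots> \<le> (\<Sum>W\<in>?X - (X1 \<union> X2). ?G W)" by (intro sum_mono G)
  also have "\<dots> \<le> (\<Sum>W\<in>?X. ?G W)" by (intro sum_mono2 fin) (use G0 in auto)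
  finally show ?thesis .
qed

end

section \<open>Binomial estimates and choice of constants\<close>

text \<open>Two steps of Pascal's rule peel off adjacent binomials; doubling the larger one leaves
  every second term of the hockey-stick sum.\<close>

lemma binomial_le_sum_step_two:
  assumes "k > 0"
  shows "j \<le> 2 * L \<Longrightarrow> j choose Suc k \<le> 2 * (\<Sum>t<L. (Suc j - 2 * Suc t) choose k)"
proof (induction L arbitrary: j)
  case (Suc L)
  show ?case
  proof (cases "j < 2")
    case True
    then show ?thesis using assms by (simp add: binomial_eq_0)
  next
    case False
    then obtain i where j: "j = Suc (Suc i)" by (metis add_2_eq_Suc le_Suc_ex not_less)
    have "j choose Suc k = (Suc i choose k) + (i choose k) + (i choose Suc k)" by (simp add: j)
    also have "i choose k \<le> Suc i choose k" using binomial_right_mono[of i "Suc i" k] by simp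
    also have "i choose Suc k \<le> 2 * (\<Sum>t<L. (Suc i - 2 * Suc t) choose k)"
      using Suc by (simp add: j)
    finally show ?thesis
      by (simp add: j sum.lessThan_Suc_shift del: sum.lessThan_Suc binomial_Suc_Suc)
  qed
qed (use assms in simp)

text \<open>With \<open>h = n div 2\<close> and \<open>k = surplus n\<close>, absorption identities
  turn the bound of \<open>binomial_le_sum_step_two\<close> into
  \<open>(h - k) * (h + 1 - k) / (2 * (k + 1) * (h + 1))\<close>. The constant \<open>6\<close> is
  \<open>2 * (k + 1)\<close> in the worse case \<open>k = 2\<close>.\<close>

lemma sum_avoid_prob_ge:
  assumes "n \<ge> 4" "n div 2 \<le> 2 * L"
  shows "(real (n div 2) - 4) / 6 \<le> (\<Sum>t<L. avoid_prob n t)"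
proof -
  define h where "h = n div 2"
  define k where "k = surplus n"
  have h: "h \<ge> 2" using assms by (simp add: h_def)
  have k: "k > 0" "k \<le> 2" unfolding k_def surplus_def by presburger+
  have M: "real (Suc h choose k) > 0" using k h by simp
  have 1: "real (Suc k) * real (h choose Suc k) = real (h - k) * real (h choose k)"
    using binomial_absorption[of k h] binomial_absorb_comp[of h k] by (metis of_nat_mult)
  have 2: "real (Suc h - k) * real (Suc h choose k) = real (Suc h) * real (h choose k)"
    using binomial_absorb_comp[of "Suc h" k] by (metis diff_Suc_1 of_nat_mult)
  have "real (Suc k) * real (Suc h) * real (h choose Suc k) =
      real (h - k) * (real (Suc h) * real (h choose k))"
    using 1 by (simp add: mult_ac del: of_nat_Suc)
  also have "\<dots> = real (h - k) * real (Suc h - k) * real (Suc h choose k)"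
    unfolding 2[symmetric] by simp
  finally have 3: "real (Suc k) * real (Suc h) * real (h choose Suc k) =
    real (h - k) * real (Suc h - k) * real (Suc h choose k)" .
  have "(real h - 4) * (real h + 1) \<le> (real h - 2) * (real h - 1)" by (simp add: algebra_simps)
  also have "\<dots> \<le> real (h - k) * real (Suc h - k)"
    using h k by (intro mult_mono) (auto simp: of_nat_diff)
  finally have "(real h - 4) * (real h + 1) * real (Suc h choose k) \<le>
      real (Suc k) * real (Suc h) * real (h choose Suc k)"
    unfolding 3 by (intro mult_right_mono) auto
  also have "\<dots> \<le> 3 * real (Suc h) * real (h choose Suc k)"
    using k by (intro mult_right_mono) auto
  finally have "(real h - 4) * real (Suc h choose k) * (real h + 1) \<le>
      3 * real (h choose Suc k) * (real h + 1)"
    by (simp add: algebra_simps)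
  then have "(real h - 4) * real (Suc h choose k) \<le> 3 * real (h choose Suc k)"
    by (rule mult_right_le_imp_le) simp
  also have "real (h choose Suc k) \<le> real (2 * (\<Sum>t<L. (Suc h - 2 * Suc t) choose k))"
    using binomial_le_sum_step_two[OF k(1), of h L] assms(2) by (simp only: of_nat_le_iff h_def)
  finally have "(real h - 4) / 6 \<le>
      (\<Sum>t<L. real ((Suc h - 2 * Suc t) choose k)) / real (Suc h choose k)"
    using M by (simp add: field_simps)
  also have "\<dots> = (\<Sum>t<L. avoid_prob n t)"
    by (simp add: avoid_prob_def h_def k_def sum_divide_distrib)
  finally show ?thesis by (simp add: h_def)
qed

text \<open>The middle coefficient is the largest of \<open>n + 1\<close>, and its right neighbor is
  at least half as large. This polynomial loss is harmless against exponential tails.\<close>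

lemma card_majority_sets_ge:
  assumes "n > 0"
  shows "2 ^ n / (2 * (real n + 1)) \<le> card (majority_sets n)"
proof -
  define h where "h = n div 2"
  have "(2::nat) ^ n = (\<Sum>i\<le>n. n choose i)" by (simp add: choose_row_sum)
  also have "\<dots> \<le> (\<Sum>i\<le>n. n choose h)" by (intro sum_mono) (simp add: h_def binomial_maximum)
  also have "\<dots> = (n + 1) * (n choose h)" by simp
  finally have 1: "2 ^ n \<le> (n + 1) * (n choose h)" .
  have "Suc h * (n choose h) \<le> 2 * ((n - h) * (n choose h))"
  proof -
    have "h < n" "2 * h \<le> n" using assms by (auto simp: h_def)
    then have "Suc h \<le> 2 * (n - h)" by linarith
    from mult_le_mono1[OF this, of "n choose h"] show ?thesis by (simp only: mult.assoc)
  qed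
  also have "\<dots> = Suc h * (2 * (n choose Suc h))"
    using binomial_absorption[of h n] binomial_absorb_comp[of n h] by simp
  finally have "n choose h \<le> 2 * (n choose Suc h)" by (simp only: mult_le_cancel1)
  then have "2 ^ n \<le> (n + 1) * (2 * (n choose Suc h))"
    using 1 by (meson le_trans mult_le_mono2)
  then have "real (2 ^ n) \<le> real ((n + 1) * (2 * (n choose Suc h)))" by (simp only: of_nat_le_iff)
  then show ?thesis by (simp add: card_majority_sets h_def field_simps)
qed

text \<open>The right side is \<open>1 / 10000\<close> of the density guaranteed by
  \<open>card_majority_sets_ge\<close>, so exceptional runs are a negligible share of the majority
  sets.\<close>

lemma eventually_small_tails:
  "eventually (\<lambda>n. exp (- (real n / 10 ^ 8)) + (1 / 2) ^ (n div 10000) \<le>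
     1 / (20000 * (real n + 1))) at_top"
proof -
  \<comment> \<open>A smooth exponent replaces the rounded quotient; the summand \<open>1\<close>
    absorbs the rounding.\<close>
  have "eventually (\<lambda>n. exp (- (real n / 10 ^ 8)) + 2 powr (1 - real n / 10000) \<le>
     1 / (20000 * (real n + 1))) at_top"
  proof -
    have "((\<lambda>n. (real n + 1) * exp (- (real n / 10 ^ 8))) \<longlongrightarrow> 0) at_top"
      by real_asymp
    then have "eventually (\<lambda>n. (real n + 1) * exp (- (real n / 10 ^ 8)) < 1 / 40000) at_top"
      by (rule order_tendstoD) simp
    moreover have "((\<lambda>n. (real n + 1) * 2 powr (1 - real n / 10000)) \<longlongrightarrow> 0) at_top"
      by real_asymp
    then have "eventually (\<lambda>n. (real n + 1) * 2 powr (1 - real n / 10000) < 1 / 40000) at_top"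
      by (rule order_tendstoD) simp
    ultimately show ?thesis
    proof eventually_elim
      case (elim n)
      then show ?case by (simp add: field_simps)
    qed
  qed
  then show ?thesis
  proof eventually_elim
    case (elim n)
    have "real n \<le> 10000 * real (n div 10000) + 10000"
    proof -
      have "n \<le> 10000 * (n div 10000) + 10000"
        using div_mult_mod_eq[of n 10000] mod_less_divisor[of 10000 n] by linarith
      then show ?thesis by linarith
    qed
    then have "- real (n div 10000) \<le> 1 - real n / 10000" by simp
    then have "2 powr (- real (n div 10000)) \<le> 2 powr (1 - real n / 10000)" by simp
    then show ?case
      using elim by (simp add: powr_minus powr_realpow power_one_over inverse_eq_divide)
  qed
qed

lemma (in exact_solver) sum_length_run_ge_linear:
  assumes "n \<ge> 100000"
    and tails: "exp (- (real n / 10 ^ 8)) + (1 / 2) ^ (n div 10000) \<le> 1 / (20000 * (real n + 1))"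
  shows "1.019 * real n * card (majority_sets n) \<le> (\<Sum>W\<in>majority_sets n. real (length (run W)))"
proof -
  let ?X = "majority_sets n"
  \<comment> \<open>With these choices \<open>\<delta> * L / 2\<close> and
    \<open>\<eta> / \<delta>\<close> cost at most \<open>n / 20000\<close> and
    \<open>n / 10000\<close>, and \<open>L\<close> lies within \<open>n / 10000\<close> of
    \<open>n\<close>.\<close>
  define \<delta> :: real where "\<delta> = 1 / 10000"
  define \<eta> where "\<eta> = real n / 10 ^ 8"
  define L where "L = n - n div 10000"
  define B where "B = (\<Sum>t<L. mean_gain n t) - \<delta> * L / 2 - \<eta> / \<delta>"
  have n: "n > 0" using assms by simp
  have L: "9999 / 10000 * real n \<le> real L" "real L \<le> real n"
  proof -
    have "10000 * (n div 10000) \<le> n" by simp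
    then have "real (n div 10000) \<le> real n / 10000" by linarith
    then show "9999 / 10000 * real n \<le> real L" by (simp add: L_def of_nat_diff)
  qed (simp add: L_def)
  have h: "real n \<le> 2 * real (n div 2) + 1"
  proof -
    have "n \<le> 2 * (n div 2) + 1" by presburger
    then show ?thesis by linarith
  qed
  have "n div 10000 \<le> n div 2" "2 * (n div 2) \<le> n" by (simp_all add: div_le_mono2)
  then have "n div 2 \<le> 2 * L" unfolding L_def by linarith
  then have "(real (n div 2) - 4) / 6 \<le> (\<Sum>t<L. avoid_prob n t)"
    using assms(1) by (intro sum_avoid_prob_ge) auto
  moreover have "(\<Sum>t<L. mean_gain n t) = real L / 2 + (\<Sum>t<L. avoid_prob n t) / 4"
    by (simp add: mean_gain_def sum_divide_distrib sum.distrib add_divide_distrib)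
  \<comment> \<open>The main terms \<open>n / 2\<close> and \<open>n / 48\<close> add up to about
    \<open>0.5208 * n\<close>; all losses fit into the gap to \<open>0.52 * n\<close>.\<close>
  ultimately have B: "0.52 * real n \<le> B"
    using L h assms(1) unfolding B_def \<delta>_def \<eta>_def by simp
  have "2 ^ L = 2 ^ n * (1 / 2 :: real) ^ (n div 10000)"
    by (simp add: L_def power_diff power_one_over)
  then have "2 ^ n * exp (- \<eta>) + 2 ^ L =
      2 ^ n * (exp (- (real n / 10 ^ 8)) + (1 / 2) ^ (n div 10000))"
    by (simp add: \<eta>_def distrib_left)
  also have "\<dots> \<le> 2 ^ n * (1 / (20000 * (real n + 1)))"
    using tails by (intro mult_left_mono) auto
  also have "\<dots> = 2 ^ n / (2 * (real n + 1)) / 10000" by simp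
  also have "\<dots> \<le> card ?X / 10000" using card_majority_sets_ge[OF n] by (intro divide_right_mono) auto
  finally have bad: "0.9999 * real (card ?X) \<le> card ?X - 2 ^ n * exp (- \<eta>) - 2 ^ L" by simp
  have "1.019 * real n * card ?X \<le> (real (n div 2) + 0.9999 * (0.52 * real n)) * card ?X"
    using h assms(1) by (intro mult_right_mono) auto
  also have "\<dots> = real (n div 2) * card ?X + 0.9999 * real (card ?X) * (0.52 * real n)"
    by (simp add: algebra_simps)
  also have "0.9999 * real (card ?X) * (0.52 * real n) \<le>
      (card ?X - 2 ^ n * exp (- \<eta>) - 2 ^ L) * B"
    using bad B by (intro mult_mono) (auto intro: order.trans[rotated])
  also have "\<dots> \<le> (\<Sum>W\<in>?X. list_weight (gain n) 0 (run_links W))"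
    using B by (intro sum_gain_ge[OF n, of \<delta>]) (auto simp: \<delta>_def B_def)
  also have "real (n div 2) * card ?X + (\<Sum>W\<in>?X. list_weight (gain n) 0 (run_links W)) =
      (\<Sum>W\<in>?X. real (n div 2) + list_weight (gain n) 0 (run_links W))"
    by (simp add: sum.distrib)
  also have "\<dots> \<le> (\<Sum>W\<in>?X. real (length (run W)))" by (rule sum_length_run_ge[OF n])
  finally show ?thesis by simp
qed

section \<open>From decision trees to randomized algorithms\<close>

lemma sum_comparisons_ge:
  assumes "n \<ge> 100000"
    and "exp (- (real n / 10 ^ 8)) + (1 / 2) ^ (n div 10000) \<le> 1 / (20000 * (real n + 1))"
    and "set_algo A \<subseteq> {1..n}"
    and "\<And>(c :: nat \<Rightarrow> nat) k r. reports_after c A k r \<Longrightarrow> correct_report n c r"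
    and "\<And>W. W \<in> majority_sets n \<Longrightarrow> halts (two_coloring W) A"
  shows "ennreal (1.019 * real n) * of_nat (card (majority_sets n)) \<le>
    (\<Sum>W\<in>majority_sets n. comparisons (two_coloring W) A)"
proof -
  let ?X = "majority_sets n"
  obtain k where k: "\<And>W. W \<in> ?X \<Longrightarrow> \<exists>r. reports_after (two_coloring W) A (k W) r"
    using assms(5) unfolding halts_def by metis
  define K where "K = Max (k ` ?X)"
  interpret exact_solver n A K
  proof
    fix W assume W: "W \<in> ?X"
    then have "k W \<le> K" by (simp add: K_def finite_majority_sets)
    then show "\<exists>r. reports_after (two_coloring W) A K r"
      using k[OF W] reports_after_mono by blast
  qed (use assms(3,4) in auto)
  have "ennreal (1.019 * real n) * of_nat (card ?X) = ennreal (1.019 * real n * card ?X)"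
    by (simp only: ennreal_of_nat_eq_real_of_nat) (rule ennreal_mult[symmetric]; simp)
  also have "\<dots> \<le> ennreal (\<Sum>W\<in>?X. real (length (run W)))"
    by (intro ennreal_leI sum_length_run_ge_linear assms)
  also have "\<dots> = (\<Sum>W\<in>?X. of_nat (length (run W)))"
    by (subst sum_ennreal[symmetric]) (simp_all add: ennreal_of_nat_eq_real_of_nat)
  also have "\<dots> \<le> (\<Sum>W\<in>?X. comparisons (two_coloring W) A)"
    by (intro sum_mono comparisons_ge_length_transcript)
  finally show ?thesis .
qed

theorem theorem4p7:
  "\<exists>N. \<forall>n \<ge> N. \<forall>M :: nat algo measure.
     randomized_algo n M \<and> reports_majority_exactly n M \<longrightarrow>
     (\<exists>c :: nat \<Rightarrow> nat. expected_comparisons M c \<ge> ennreal (1.019 * real n))"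
proof -
  obtain N where N: "\<And>n. n \<ge> N \<Longrightarrow>
      exp (- (real n / 10 ^ 8)) + (1 / 2) ^ (n div 10000) \<le> 1 / (20000 * (real n + 1))"
    using eventually_small_tails by (auto simp: eventually_at_top_linorder)
  show ?thesis
  proof (intro exI[of _ "max N 100000"] allI impI)
    fix n and M :: "nat algo measure"
    assume n: "max N 100000 \<le> n"
      and M: "randomized_algo n M \<and> reports_majority_exactly n M"
    let ?X = "majority_sets n" and ?C = "\<lambda>W. comparisons (two_coloring W :: nat \<Rightarrow> nat)"
    interpret prob_space M using M by (simp add: randomized_algo_def)
    have meas: "?C W \<in> borel_measurable M" for W
      using M by (simp add: randomized_algo_def)
    have "0 < 2 ^ n / (2 * (real n + 1))" by simp
    also have "\<dots> \<le> card ?X" using card_majority_sets_ge[of n] n by simp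
    finally have cardX: "card ?X > 0" by simp
    have fin: "finite ?X" "?X \<noteq> {}" using cardX by (auto simp: card_gt_0_iff)
    \<comment> \<open>Halting is almost sure for each coloring separately; finitely many null sets
      combine.\<close>
    have "AE A in M. \<forall>W\<in>?X. halts (two_coloring W :: nat \<Rightarrow> nat) A"
      using M fin by (intro AE_finite_allI) (auto simp: reports_majority_exactly_def)
    then have "AE A in M. ennreal (1.019 * real n) * of_nat (card ?X) \<le> (\<Sum>W\<in>?X. ?C W A)"
      using AE_space
    proof eventually_elim
      case (elim A)
      show ?case
        by (rule sum_comparisons_ge)
          (use n N elim M in \<open>auto simp: randomized_algo_def reports_majority_exactly_def\<close>)
    qed
    then have "(\<integral>\<^sup>+ A. ennreal (1.019 * real n) * of_nat (card ?X) \<partial>M) \<le>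
        (\<integral>\<^sup>+ A. (\<Sum>W\<in>?X. ?C W A) \<partial>M)"
      by (rule nn_integral_mono_AE)
    also have "\<dots> = (\<Sum>W\<in>?X. expected_comparisons M (two_coloring W))"
      unfolding expected_comparisons_def by (rule nn_integral_sum) (rule meas)
    \<comment> \<open>The mean over the two-colorings is at most the maximum, which a fixed coloring
      attains.\<close>
    also have "\<dots> \<le> of_nat (card ?X) * Max (expected_comparisons M ` two_coloring ` ?X)"
      by (rule sum_bounded_above) (use fin in auto)
    finally have "of_nat (card ?X) * ennreal (1.019 * real n) \<le>
        of_nat (card ?X) * Max (expected_comparisons M ` two_coloring ` ?X)"
      by (simp add: emeasure_space_1 mult.commute)
    then have "ennreal (1.019 * real n) \<le> Max (expected_comparisons M ` two_coloring ` ?X)"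
      using cardX by (subst (asm) ennreal_mult_le_mult_iff) auto
    moreover have "Max (expected_comparisons M ` two_coloring ` ?X) \<in> expected_comparisons M ` two_coloring ` ?X"
      using fin by (intro Max_in) auto
    ultimately show "\<exists>c :: nat \<Rightarrow> nat. expected_comparisons M c \<ge> ennreal (1.019 * real n)"
      by auto
  qed
qed

end
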